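(* (1) Let $f \in \mathbb{Z}[x]$ be a monic polynomial of degree $d \ge 1$ with roots $\alpha_1, \dots, \alpha_d$, none of which is a root of unity, and let $\Delta_n(f) = \prod_{i=1}^d |\alpha_i^n - 1|$ for $n \ge 1$. Then the sequence $(\Delta_n(f))_{n\ge1}$ is everywhere locally realisable, and hence realisable. (2) Let $B_m$ denote the Bernoulli numbers, defined by $\frac{t}{e^t - 1} = \sum_{m=0}^\infty B_m \frac{t^m}{m!}$, and for $n \ge 1$ let $b_n$ be the denominator (in lowest terms, taken positive) of $B_{2n}$. Then $(b_n)_{n\ge1}$ is everywhere locally realisable, and hence realisable.
   Context: A sequence $(v_n)_{n\ge1}$ of non-negative integers is called realisable if there exist a set $X$ and a map $T: X \to X$ such that for every $n \ge 1$ the set $\mathrm{Per}_n(T) = \{x \in X : T^n(x) = x\}$ is finite and $|\mathrm{Per}_n(T)| = v_n$. For a prime $p$ and a positive integer $u$, the $p$-part $[u]_p$ is the largest power of $p$ dividing $u$. A sequence $(u_n)$ of positive integers is locally realisable at $p$ if $([u_n]_p)_{n\ge1}$ is realisable, and everywhere locally realisable if it is locally realisable at every prime $p$. *)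

theory Defs
  imports
    "HOL-Computational_Algebra.Computational_Algebra"
    "HOL-Library.Countable_Set"
    "HOL-Library.FuncSet"
begin

definition periodic_points :: "nat \<Rightarrow> 'a set \<Rightarrow> ('a \<Rightarrow> 'a) \<Rightarrow> 'a set" where
  "periodic_points n X T = {x \<in> X. (T ^^ n) x = x}"

text \<open>Sequences are indexed by the positive integers; the value at index \<open>0\<close> is never used.\<close>

definition realised_by :: "(nat \<Rightarrow> nat) \<Rightarrow> 'a set \<Rightarrow> ('a \<Rightarrow> 'a) \<Rightarrow> bool" where
  "realised_by v X T \<longleftrightarrow>
     T \<in> X \<rightarrow> X \<and>
     (\<forall>n\<ge>1. finite (periodic_points n X T) \<and> card (periodic_points n X T) = v n)"

text \<open>
  HOL cannot quantify existentially over types, so the set \<open>X\<close> is taken inside \<^typ>\<open>nat\<close>.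
  This loses nothing: the points that are periodic form a countable invariant set, and
  \<open>realised_by_imp_realisable\<close> below shows that a realisation over an arbitrary type yields
  one over \<^typ>\<open>nat\<close>.
\<close>

definition realisable :: "(nat \<Rightarrow> nat) \<Rightarrow> bool" where
  "realisable v \<longleftrightarrow> (\<exists>(X :: nat set) T. realised_by v X T)"

lemma realised_by_imp_realisable:
  fixes X :: "'a set"
  assumes "realised_by v X T"
  shows "realisable v"
proof -
  define P where "P = (\<Union>n\<in>{1..}. periodic_points n X T)"
  have TX: "T x \<in> X" if "x \<in> X" for x
    using assms that by (auto simp: realised_by_def)
  have "countable P"
    unfolding P_def using assms
    by (intro countable_UN) (auto simp: realised_by_def intro: countable_finite)
  have TP: "T x \<in> P" if "x \<in> P" for x
  proof -
    from that obtain n where "n \<ge> 1" "x \<in> X" "(T ^^ n) x = x"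
      by (auto simp: P_def periodic_points_def)
    moreover from this have "(T ^^ n) (T x) = T x"
      by (simp add: funpow_swap1 [symmetric])
    ultimately show ?thesis
      using TX by (auto simp: P_def periodic_points_def)
  qed
  define g where "g = to_nat_on P"
  define h where "h = inv_into P g"
  have inj: "inj_on g P"
    unfolding g_def using \<open>countable P\<close> by (rule inj_on_to_nat_on)
  have hg: "h (g x) = x" if "x \<in> P" for x
    using inj that by (simp add: h_def)
  define S where "S = (\<lambda>k. g (T (h k)))"
  have pow: "(S ^^ n) (g x) = g ((T ^^ n) x) \<and> (T ^^ n) x \<in> P" if "x \<in> P" for n x
    using that by (induction n) (auto simp: S_def hg TP)
  have per: "periodic_points n (g ` P) S = g ` periodic_points n X T" if "n \<ge> 1" for n
  proof -
    have "periodic_points n (g ` P) S = g ` {x \<in> P. (T ^^ n) x = x}"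
      using pow inj by (auto simp: periodic_points_def inj_on_def)
    also have "{x \<in> P. (T ^^ n) x = x} = periodic_points n X T"
      using that by (auto simp: P_def periodic_points_def)
    finally show ?thesis .
  qed
  have "realised_by v (g ` P) S"
    unfolding realised_by_def
  proof (intro conjI allI impI)
    show "S \<in> g ` P \<rightarrow> g ` P"
      by (auto simp: S_def hg TP)
  next
    fix n :: nat assume n: "n \<ge> 1"
    have fin: "finite (periodic_points n X T)" and card: "card (periodic_points n X T) = v n"
      using assms n by (auto simp: realised_by_def)
    show "finite (periodic_points n (g ` P) S)"
      using fin per[OF n] by simp
    have "periodic_points n X T \<subseteq> P"
      using n by (auto simp: P_def)
    thus "card (periodic_points n (g ` P) S) = v n"
      using card per[OF n] inj by (metis card_image inj_on_subset)
  qed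
  thus ?thesis
    unfolding realisable_def by blast
qed

definition p_part :: "nat \<Rightarrow> nat \<Rightarrow> nat" where
  "p_part p u = p ^ multiplicity p u"

definition locally_realisable_at :: "nat \<Rightarrow> (nat \<Rightarrow> nat) \<Rightarrow> bool" where
  "locally_realisable_at p u \<longleftrightarrow> (\<forall>n\<ge>1. u n > 0) \<and> realisable (\<lambda>n. p_part p (u n))"

definition everywhere_locally_realisable :: "(nat \<Rightarrow> nat) \<Rightarrow> bool" where
  "everywhere_locally_realisable u \<longleftrightarrow> (\<forall>p. prime p \<longrightarrow> locally_realisable_at p u)"

definition complex_roots :: "int poly \<Rightarrow> complex multiset" where
  "complex_roots f = proots (map_poly of_int f)"

definition root_of_unity :: "complex \<Rightarrow> bool" where
  "root_of_unity z \<longleftrightarrow> (\<exists>k\<ge>1::nat. z ^ k = 1)"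

definition Delta :: "int poly \<Rightarrow> nat \<Rightarrow> real" where
  "Delta f n = (\<Prod>\<alpha>\<in>#complex_roots f. norm (\<alpha> ^ n - 1))"

text \<open>The multiset of roots agrees with any enumeration coming from a linear factorisation.\<close>

lemma complex_roots_eqI:
  fixes d :: nat and \<alpha> :: "nat \<Rightarrow> complex"
  assumes "map_poly of_int f = (\<Prod>i=1..d. [:- \<alpha> i, 1:])"
  shows "complex_roots f = image_mset \<alpha> (mset_set {1..d})"
    and "Delta f n = (\<Prod>i=1..d. norm (\<alpha> i ^ n - 1))"
proof -
  have "complex_roots f = (\<Sum>i=1..d. proots [:- \<alpha> i, 1:])"
    unfolding complex_roots_def assms by (rule proots_prod) auto
  also have "\<dots> = (\<Sum>i=1..d. {#\<alpha> i#})"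
    by simp
  also have "\<dots> = image_mset \<alpha> (mset_set {1..d})"
    by (induction d) (simp_all add: atLeastAtMostSuc_conv)
  finally show *: "complex_roots f = image_mset \<alpha> (mset_set {1..d})" .
  show "Delta f n = (\<Prod>i=1..d. norm (\<alpha> i ^ n - 1))"
    unfolding Delta_def * by (simp add: prod_unfold_prod_mset image_mset.compositionality o_def)
qed

text \<open>Division is that of formal power series over \<open>\<rat>\<close>; see \<open>bernoulli_generating_function\<close>.\<close>

definition bernoulli :: "nat \<Rightarrow> rat" where
  "bernoulli m = fact m * fps_nth (fps_X / (fps_exp 1 - 1)) m"

lemma bernoulli_generating_function:
  "(fps_exp 1 - 1) * Abs_fps (\<lambda>m. bernoulli m / fact m) = fps_X"
proof -
  let ?E = "fps_exp 1 - 1 :: rat fps"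
  have "fps_nth ?E 0 = 0" "fps_nth ?E 1 \<noteq> 0"
    by simp_all
  hence "subdegree ?E = 1"
    by (intro subdegreeI) auto
  moreover from this have "?E \<noteq> 0"
    by auto
  ultimately have "?E dvd fps_X"
    by (subst fps_dvd_iff) auto
  moreover have "Abs_fps (\<lambda>m. bernoulli m / fact m) = fps_X / ?E"
    by (simp add: fps_eq_iff bernoulli_def)
  ultimately show ?thesis
    by simp
qed

text \<open>\<^const>\<open>quotient_of\<close> returns the fraction in lowest terms with positive denominator.\<close>

definition bernoulli_denom :: "nat \<Rightarrow> nat" where
  "bernoulli_denom n = nat (snd (quotient_of (bernoulli (2 * n))))"

end

(*
  (1) Up to sign, the product of the alpha_i^n - 1 is the determinant of the n x n circulant matrix
  of f, whose eigenvalues are the values of f at the n-th roots of unity. An integer matrix with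
  determinant D <> 0 has exactly [D]_p kernel elements on the vectors over Z[1/p]/Z, and for the
  circulant matrix these are the sequences over Z[1/p]/Z that satisfy the linear recurrence with
  characteristic polynomial f and have period n. So the shift on all sequences satisfying this
  recurrence realises the p-parts.

  (2) Expanding the power sum 0^m + ... + (p-1)^m in Bernoulli numbers shows that it is congruent to
  p B_m modulo p for even m > 0, whence [b_n]_p is p if p - 1 divides 2n and 1 otherwise. This is
  realised by a fixed point together with cycles of length (p - 1)/2 (or length 1 if p = 2).

  Local realisability at all primes gives realisability by taking the product of the systems.
*)
theory Submission
  imports
    Defs
    "HOL-Number_Theory.Residue_Primitive_Roots"
    "Jordan_Normal_Form.Determinant"
begin

section \<open>Realisable sequences\<close>

lemma realisable_cong:
  assumes "\<And>n. n \<ge> 1 \<Longrightarrow> v n = w n"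
  shows "realisable v \<longleftrightarrow> realisable w"
  using assms by (simp add: realisable_def realised_by_def)

text \<open>
  For fixed \<open>n\<close> all but finitely many of the systems realising the \<open>p\<close>-parts have exactly one
  point of period \<open>n\<close>, so their infinite product still has only finitely many.
\<close>

lemma everywhere_locally_realisable_imp_realisable:
  assumes "everywhere_locally_realisable u"
  shows "realisable u"
proof -
  let ?P = "{p :: nat. prime p}"
  have "\<exists>(X :: nat set) T. realised_by (\<lambda>n. p_part p (u n)) X T" if "prime p" for p
    using assms that
    by (auto simp: everywhere_locally_realisable_def locally_realisable_at_def realisable_def)
  then obtain X :: "nat \<Rightarrow> nat set" and T where
    XT: "\<And>p. prime p \<Longrightarrow> realised_by (\<lambda>n. p_part p (u n)) (X p) (T p)"
    by metis
  have upos: "u n > 0" if "n \<ge> 1" for n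
    using assms that two_is_prime_nat
    unfolding everywhere_locally_realisable_def locally_realisable_at_def by blast
  \<comment> \<open>\<open>PiE\<close> pins the values at non-primes to \<open>undefined\<close>, so
    points of the product are equal once they agree at all primes. The map \<open>S\<close>
    restricts again for the same reason.\<close>
  define Y where "Y = PiE ?P X"
  define S where "S = (\<lambda>x :: nat \<Rightarrow> nat. restrict (\<lambda>p. T p (x p)) ?P)"
  have TX: "T p y \<in> X p" if "prime p" "y \<in> X p" for p y
    using XT[OF that(1)] that(2) by (auto simp: realised_by_def)
  have SY: "S \<in> Y \<rightarrow> Y"
    unfolding S_def Y_def using TX by (auto simp: PiE_iff extensional_def)
  have pow: "(S ^^ n) x = restrict (\<lambda>p. (T p ^^ n) (x p)) ?P" if "x \<in> Y" for n x
  proof (induction n)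
    case 0
    from that show ?case by (simp add: Y_def PiE_restrict)
  next
    case (Suc n)
    thus ?case by (auto simp: S_def fun_eq_iff)
  qed
  have "realised_by u Y S"
    unfolding realised_by_def
  proof (intro conjI allI impI SY)
    fix n :: nat assume n: "n \<ge> 1"
    define Q where "Q = (\<lambda>p. periodic_points n (X p) (T p))"
    have fin: "finite (Q p)" and card: "card (Q p) = p_part p (u n)" if "prime p" for p
      using XT[OF that] n by (auto simp: realised_by_def Q_def)
    have per: "periodic_points n Y S = PiE ?P Q"
    proof (intro Set.set_eqI iffI)
      fix x assume x: "x \<in> periodic_points n Y S"
      hence xY: "x \<in> Y" and "(S ^^ n) x = x"
        by (auto simp: periodic_points_def)
      hence "restrict (\<lambda>p. (T p ^^ n) (x p)) ?P = x" using pow by simp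
      hence "(T p ^^ n) (x p) = x p" if "prime p" for p
        using that by (auto simp: fun_eq_iff restrict_def split: if_splits)
      with xY show "x \<in> PiE ?P Q"
        by (auto simp: Y_def PiE_iff Q_def periodic_points_def)
    next
      fix x assume x: "x \<in> PiE ?P Q"
      hence xY: "x \<in> Y" by (auto simp: Y_def PiE_iff Q_def periodic_points_def)
      have "(S ^^ n) x = x"
        unfolding pow[OF xY] using x
        by (auto simp: fun_eq_iff PiE_iff Q_def periodic_points_def extensional_def)
      with xY show "x \<in> periodic_points n Y S" by (simp add: periodic_points_def)
    qed
    define F where "F = prime_factors (u n)"
    have F: "finite F" "F \<subseteq> ?P" by (auto simp: F_def)
    have single: "\<exists>e. Q p = {e}" if "prime p" "p \<notin> F" for p
    proof -
      have "\<not> p dvd u n" using that upos[OF n] by (auto simp: F_def prime_factors_dvd)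
      hence "card (Q p) = 1"
        using card[OF that(1)] by (simp add: p_part_def not_dvd_imp_multiplicity_0)
      thus ?thesis by (simp add: card_1_singleton_iff)
    qed
    then obtain e where e: "\<And>p. prime p \<Longrightarrow> p \<notin> F \<Longrightarrow> Q p = {e p}" by metis
    \<comment> \<open>Forgetting the coordinates outside the finite set \<open>F\<close> loses
      nothing: the inverse fills them in with the unique points \<open>e p\<close>.\<close>
    have bij: "bij_betw (\<lambda>x. restrict x F) (PiE ?P Q) (PiE F Q)"
    proof (rule bij_betw_byWitness[where f' = "\<lambda>y. restrict (\<lambda>p. if p \<in> F then y p else e p) ?P"])
      show "\<forall>x\<in>PiE ?P Q. restrict (\<lambda>p. if p \<in> F then restrict x F p else e p) ?P = x"
      proof
        fix x assume x: "x \<in> PiE ?P Q"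
        have "x p = e p" if "prime p" "p \<notin> F" for p
          using x e[OF that] that by (auto simp: PiE_iff)
        thus "restrict (\<lambda>p. if p \<in> F then restrict x F p else e p) ?P = x"
          using x by (auto simp: fun_eq_iff PiE_iff extensional_def)
      qed
      show "\<forall>y\<in>PiE F Q. restrict (restrict (\<lambda>p. if p \<in> F then y p else e p) ?P) F = y"
        using F by (auto simp: fun_eq_iff PiE_iff extensional_def)
      show "(\<lambda>x. restrict x F) ` PiE ?P Q \<subseteq> PiE F Q"
        using F by (auto simp: PiE_iff)
      show "(\<lambda>y. restrict (\<lambda>p. if p \<in> F then y p else e p) ?P) ` PiE F Q \<subseteq> PiE ?P Q"
        using F e by (auto simp: PiE_iff extensional_def split: if_splits)
    qed
    have finF: "finite (PiE F Q)" using F fin by (intro finite_PiE) auto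
    show "finite (periodic_points n Y S)"
      unfolding per using bij finF bij_betw_finite by blast
    have "card (PiE ?P Q) = card (PiE F Q)" using bij by (rule bij_betw_same_card)
    also have "\<dots> = (\<Prod>p\<in>F. card (Q p))" using F by (simp add: card_PiE)
    also have "\<dots> = (\<Prod>p\<in>F. p ^ multiplicity p (u n))"
      using F card by (intro prod.cong) (auto simp: p_part_def)
    also have "\<dots> = u n"
      using upos[OF n] prime_factorization_nat[of "u n"] by (simp add: F_def)
    finally show "card (periodic_points n Y S) = u n" by (simp add: per)
  qed
  thus ?thesis by (rule realised_by_imp_realisable)
qed

text \<open>\<open>None\<close> is the fixed point and the pairs \<open>(a, i)\<close> form
  \<open>k\<close> disjoint cycles of length \<open>m\<close>, whose points return after
  \<open>n\<close> steps exactly when \<open>m\<close> divides \<open>n\<close>. This is the model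
  for sequences with only two values, such as the p-parts of the Bernoulli denominators.\<close>

lemma realisable_fixed_point_and_cycles:
  fixes m k :: nat
  assumes "m > 0"
  shows "realisable (\<lambda>n. if m dvd n then Suc (k * m) else 1)"
proof -
  define X :: "(nat \<times> nat) option set" where "X = insert None (Some ` ({..<k} \<times> {..<m}))"
  define T :: "(nat \<times> nat) option \<Rightarrow> (nat \<times> nat) option"
    where "T = map_option (\<lambda>(a, i). (a, Suc i mod m))"
  have pow: "(T ^^ n) (Some (a, i)) = Some (a, (i + n) mod m)" if "i < m" for a i n
    using that by (induction n) (auto simp: T_def mod_Suc_eq)
  have powN: "(T ^^ n) None = None" for n
    by (induction n) (auto simp: T_def)
  have fin: "finite X" by (simp add: X_def)
  have card: "card X = Suc (k * m)"
    unfolding X_def by (subst card_insert_disjoint) (auto simp: card_image)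
  have per: "periodic_points n X T = (if m dvd n then X else {None})" for n
  proof -
    have "(i + n) mod m = i \<longleftrightarrow> m dvd n" if "i < m" for i
      using that by (metis add_diff_cancel_left' le_add1 mod_eq_dvd_iff_nat mod_less)
    thus ?thesis
      by (auto simp: periodic_points_def X_def pow powN)
  qed
  have "T \<in> X \<rightarrow> X" using assms by (auto simp: X_def T_def)
  hence "realised_by (\<lambda>n. if m dvd n then Suc (k * m) else 1) X T"
    unfolding realised_by_def per using fin card by auto
  thus ?thesis by (rule realised_by_imp_realisable)
qed

section \<open>Torsion points and determinants\<close>

lemma frac_eq_frac_iff:
  fixes x y :: "'a :: floor_ceiling"
  shows "frac x = frac y \<longleftrightarrow> x - y \<in> \<int>"
proof
  assume "frac x = frac y"
  hence "x - y = of_int (\<lfloor>x\<rfloor> - \<lfloor>y\<rfloor>)" by (simp add: frac_def algebra_simps)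
  thus "x - y \<in> \<int>" by (metis Ints_of_int)
next
  assume "x - y \<in> \<int>"
  hence "frac (y + (x - y)) = frac y" by (rule frac_add_int_right)
  thus "frac x = frac y" by simp
qed

text \<open>Representatives of \<open>\<int>[1/p] / \<int>\<close>.\<close>

definition unit_p_fractions :: "nat \<Rightarrow> rat set" where
  "unit_p_fractions p = {r. 0 \<le> r \<and> r < 1 \<and> (\<exists>k. of_nat p ^ k * r \<in> \<int>)}"

lemma frac_in_unit_p_fractions:
  assumes "prime p" "x \<in> \<int>"
  shows "frac (x / of_nat (p ^ k)) \<in> unit_p_fractions p"
proof -
  have p: "p > 0" using assms(1) by (rule prime_gt_0_nat)
  have "of_nat p ^ k * frac (x / of_nat (p ^ k)) = x - of_nat p ^ k * of_int \<lfloor>x / of_nat (p ^ k)\<rfloor>"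
    using p by (simp add: frac_def field_simps)
  also have "\<dots> \<in> \<int>" using assms(2) by (intro Ints_diff Ints_mult Ints_power) auto
  finally show ?thesis
    unfolding unit_p_fractions_def by (auto simp: frac_ge_0 frac_lt_1)
qed

text \<open>Write c = q s' with q the p-part of c up to sign. On Z[1/p]/Z, multiplication by s' is
  bijective, and multiplication by q is surjective with kernel the q classes of a/q. So every fibre
  of multiplication by c has q elements; the one over -t is counted.\<close>

lemma card_linear_congruence:
  fixes c :: int and t :: rat
  assumes p: "prime p" and c: "c \<noteq> 0" and t: "of_nat p ^ k * t \<in> \<int>"
  shows "finite {y \<in> unit_p_fractions p. of_int c * y + t \<in> \<int>}"
    and "card {y \<in> unit_p_fractions p. of_int c * y + t \<in> \<int>} = p_part p (nat \<bar>c\<bar>)"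
proof -
  define v where "v = multiplicity p (nat \<bar>c\<bar>)"
  define q where "q = p ^ v"
  have p2: "p \<ge> 2" using p by (rule prime_ge_2_nat)
  hence p0: "p \<noteq> 0" by auto
  obtain s where s: "nat \<bar>c\<bar> = q * s" "\<not> p dvd s"
    using multiplicity_decompose'[of "nat \<bar>c\<bar>" p] c p2 unfolding q_def v_def
    by (metis nat_0_iff abs_le_zero_iff not_prime_unit p)
  define s' where "s' = sgn c * int s"
  have c_eq: "c = int q * s'"
  proof -
    have "c = sgn c * \<bar>c\<bar>" by (simp add: sgn_mult_abs)
    also have "\<bar>c\<bar> = int q * int s" using s(1) by (metis abs_ge_zero int_nat_eq of_nat_mult)
    finally show ?thesis by (simp add: s'_def mult_ac)
  qed
  have s'0: "\<not> int p dvd s'"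
    using s(2) c by (auto simp: s'_def sgn_if)
  have q0: "q > 0" using p2 by (simp add: q_def)
  text \<open>A solution \<open>y0\<close> is obtained by inverting \<open>s'\<close> modulo a large power of \<open>p\<close>; the others
    differ from it by multiples of \<open>1/q\<close>.\<close>
  have cop: "coprime s' (int p ^ l)" for l
    using prime_imp_coprime[of "int p" s'] s'0 p by (simp add: coprime_commute)
  obtain w z where wz: "w * s' + z * int p ^ k = 1"
    using bezout_int[of s' "int p ^ k"] cop[of k] by (auto simp: coprime_iff_gcd_eq_1)
  define y0 where "y0 = - of_int w * t / of_nat q"
  have y0: "of_int c * y0 + t \<in> \<int>"
  proof -
    have "of_int c * y0 + t = (1 - of_int (w * s')) * t"
      using q0 by (simp add: c_eq y0_def field_simps)
    also have "1 - of_int (w * s') = (of_int (z * int p ^ k) :: rat)"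
      using wz by (metis add_diff_cancel_left' of_int_1 of_int_diff)
    also have "of_int (z * int p ^ k) * t = of_int z * (of_nat p ^ k * t)"
      by simp
    also have "\<dots> \<in> \<int>" by (rule Ints_mult[OF Ints_of_int t])
    finally show ?thesis .
  qed
  have y0d: "of_nat p ^ (k + v) * y0 \<in> \<int>"
  proof -
    have "of_nat p ^ (k + v) * y0 = - of_int w * (of_nat p ^ k * t)"
      using p2 by (simp add: y0_def q_def power_add)
    also have "\<dots> \<in> \<int>" by (rule Ints_mult[OF Ints_minus[OF Ints_of_int] t])
    finally show ?thesis .
  qed
  \<comment> \<open>\<open>frac\<close> moves each solution to its representative in [0, 1).\<close>
  define g where "g = (\<lambda>a. frac (y0 + of_nat a / of_nat q))"
  have "bij_betw g {..<q} {y \<in> unit_p_fractions p. of_int c * y + t \<in> \<int>}"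
    unfolding bij_betw_def
  proof
    show "inj_on g {..<q}"
    proof (rule inj_onI)
      fix a b assume ab: "a \<in> {..<q}" "b \<in> {..<q}" "g a = g b"
      hence "(y0 + of_nat a / of_nat q) - (y0 + of_nat b / of_nat q) \<in> \<int>"
        unfolding g_def by (metis frac_eq_frac_iff)
      then obtain m where "(of_nat a - of_nat b) / of_nat q = (of_int m :: rat)"
        by (auto simp: Ints_def diff_divide_distrib)
      hence "(of_int (int a - int b) :: rat) = of_int (m * int q)"
        using q0 by (simp add: field_simps)
      hence *: "int a - int b = m * int q" by linarith
      have "\<bar>int a - int b\<bar> < int q" using ab by auto
      hence "\<bar>m\<bar> * int q < 1 * int q" unfolding * by (simp add: abs_mult)
      hence "m = 0" using q0 by (simp only: mult_less_cancel_right) auto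
      thus "a = b" using * by simp
    qed
    show "g ` {..<q} = {y \<in> unit_p_fractions p. of_int c * y + t \<in> \<int>}"
    proof (intro Set.set_eqI iffI)
      fix y assume "y \<in> g ` {..<q}"
      then obtain a where a: "a < q" "y = g a" by auto
      have "y0 + of_nat a / of_nat q =
          (of_nat p ^ k * of_nat q * y0 + of_nat a * of_nat p ^ k) / (of_nat p ^ k * of_nat q)"
        using p0 q0 by (simp add: add_divide_distrib)
      hence "y = frac ((of_nat p ^ (k + v) * y0 + of_nat (a * p ^ k)) / of_nat (p ^ (k + v)))"
        unfolding a g_def by (simp add: q_def power_add)
      moreover have "of_nat p ^ (k + v) * y0 + of_nat (a * p ^ k) \<in> \<int>"
        by (rule Ints_add[OF y0d Ints_of_nat])
      ultimately have "y \<in> unit_p_fractions p"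
        using frac_in_unit_p_fractions[OF p] by simp
      moreover have "of_int c * y + t = (of_int c * y0 + t) + of_int (s' * int a) - of_int (c * \<lfloor>y0 + of_nat a / of_nat q\<rfloor>)"
        using q0 unfolding a g_def frac_def by (simp add: c_eq field_simps)
      hence "of_int c * y + t \<in> \<int>" using y0 by (metis Ints_add Ints_diff Ints_of_int)
      ultimately show "y \<in> {y \<in> unit_p_fractions p. of_int c * y + t \<in> \<int>}" by simp
    next
      fix y assume "y \<in> {y \<in> unit_p_fractions p. of_int c * y + t \<in> \<int>}"
      then obtain l where y: "0 \<le> y" "y < 1" "of_nat p ^ l * y \<in> \<int>" "of_int c * y + t \<in> \<int>"
        by (auto simp: unit_p_fractions_def)
      define d where "d = y - y0"
      have "of_int c * d = (of_int c * y + t) - (of_int c * y0 + t)"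
        by (simp add: d_def algebra_simps)
      hence cd: "of_int c * d \<in> \<int>" using y(4) y0 by (metis Ints_diff)
      \<comment> \<open>This exponent clears the denominators of both \<open>y\<close> and
        \<open>y0\<close>.\<close>
      define N where "N = l + k + v"
      have Nd: "of_nat p ^ N * d \<in> \<int>"
      proof -
        have "of_nat p ^ N * d = of_nat p ^ (k + v) * (of_nat p ^ l * y) - of_nat p ^ l * (of_nat p ^ (k + v) * y0)"
          by (simp add: N_def d_def power_add algebra_simps)
        also have "\<dots> \<in> \<int>" by (intro Ints_diff Ints_mult[OF _ y(3)] Ints_mult[OF _ y0d] Ints_power Ints_of_nat)
        finally show ?thesis .
      qed
      \<comment> \<open>Both c d = q s' d and p^N d are integers. As s' is invertible modulo p^N, a
        Bezout combination shows that q d is an integer.\<close>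
      obtain w' z' where wz': "w' * s' + z' * int p ^ N = 1"
        using bezout_int[of s' "int p ^ N"] cop[of N] by (auto simp: coprime_iff_gcd_eq_1)
      have "of_nat q * d = of_int (w' * s' + z' * int p ^ N) * (of_nat q * d)"
        unfolding wz' by simp
      also have "\<dots> = of_int w' * (of_int c * d) + of_int (z' * int q) * (of_nat p ^ N * d)"
        by (simp add: c_eq algebra_simps)
      also have "\<dots> \<in> \<int>" by (intro Ints_add Ints_mult[OF _ cd] Ints_mult[OF _ Nd] Ints_of_int)
      finally obtain m where m: "of_nat q * d = of_int m" by (auto simp: Ints_def)
      \<comment> \<open>Reducing the numerator of d = m/q modulo q changes d by an integer
        only.\<close>
      define a where "a = nat (m mod int q)"
      have a: "a < q" "int a = m mod int q" using q0 by (auto simp: a_def nat_less_iff)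
      have "of_int m = (of_int (int q * (m div int q) + int a) :: rat)"
        unfolding a by (simp only: mult_div_mod_eq)
      hence "d = of_nat a / of_nat q + of_int (m div int q)"
        using m q0 by (simp add: field_simps)
      hence "y - (y0 + of_nat a / of_nat q) \<in> \<int>" by (simp add: d_def algebra_simps)
      hence "frac y = g a" unfolding g_def by (simp add: frac_eq_frac_iff)
      moreover have "frac y = y" using y by (simp add: frac_eq)
      ultimately show "y \<in> g ` {..<q}" using a by auto
    qed
  qed
  from bij_betw_finite[OF this] bij_betw_same_card[OF this]
  show "finite {y \<in> unit_p_fractions p. of_int c * y + t \<in> \<int>}"
    and "card {y \<in> unit_p_fractions p. of_int c * y + t \<in> \<int>} = p_part p (nat \<bar>c\<bar>)"
    by (simp_all add: p_part_def q_def v_def)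
qed

text \<open>This says that A kills the class of x in (Q/Z)^n. Taking x as a function on indices lets
  \<open>restrict\<close> and function update split off the last coordinate.\<close>

definition integral_image :: "nat \<Rightarrow> int mat \<Rightarrow> (nat \<Rightarrow> rat) \<Rightarrow> bool" where
  "integral_image n A x \<longleftrightarrow> (\<forall>i<n. (\<Sum>j<n. of_int (A $$ (i, j)) * x j) \<in> \<int>)"

text \<open>Row \<open>l\<close> stays in the system, so an integer multiple of it can be subtracted
  from row \<open>k\<close> again.\<close>

lemma integral_image_addrow:
  assumes A: "A \<in> carrier_mat n n" and kl: "k < n" "l < n" "k \<noteq> l"
  shows "integral_image n (addrow a k l A) x \<longleftrightarrow> integral_image n A x"
proof -
  define R where "R = (\<lambda>i. \<Sum>j<n. of_int (A $$ (i, j)) * x j)"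
  have row: "(\<Sum>j<n. of_int (addrow a k l A $$ (i, j)) * x j) =
      (if i = k then of_int a * R l + R k else R i)" if "i < n" for i
    using A that kl
    by (auto simp: R_def sum_distrib_left sum.distrib algebra_simps intro!: sum.cong)
  have "(of_int a * R l + R k \<in> \<int>) = (R k \<in> \<int>)" if "R l \<in> \<int>"
  proof -
    have *: "of_int a * R l \<in> \<int>" using that by (intro Ints_mult) auto
    have "R k \<in> \<int>" if "of_int a * R l + R k \<in> \<int>"
      using Ints_diff[OF that *] by simp
    thus ?thesis using Ints_add[OF *] by blast
  qed
  hence "(\<forall>i<n. (if i = k then of_int a * R l + R k else R i) \<in> \<int>) \<longleftrightarrow> (\<forall>i<n. R i \<in> \<int>)"
    using kl by (metis (full_types))
  thus ?thesis
    unfolding integral_image_def using row by (simp add: R_def)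
qed

lemma integral_image_swaprows:
  assumes A: "A \<in> carrier_mat n n" and kl: "k < n" "l < n"
  shows "integral_image n (swaprows k l A) x \<longleftrightarrow> integral_image n A x"
proof -
  define R where "R = (\<lambda>i. \<Sum>j<n. of_int (A $$ (i, j)) * x j)"
  have row: "(\<Sum>j<n. of_int (swaprows k l A $$ (i, j)) * x j) =
      (if i = k then R l else if i = l then R k else R i)" if "i < n" for i
    using A that kl by (auto simp: R_def intro!: sum.cong)
  have "(\<forall>i<n. (if i = k then R l else if i = l then R k else R i) \<in> \<int>) \<longleftrightarrow> (\<forall>i<n. R i \<in> \<int>)"
    using kl by (metis (full_types))
  thus ?thesis
    unfolding integral_image_def using row by (simp add: R_def)
qed

text \<open>The Euclidean algorithm on the last column, by unimodular row operations.\<close>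

lemma clear_last_column:
  assumes "A \<in> carrier_mat (Suc n) (Suc n)"
  shows "\<exists>B. B \<in> carrier_mat (Suc n) (Suc n) \<and> \<bar>det B\<bar> = \<bar>det A\<bar> \<and>
    (\<forall>x. integral_image (Suc n) B x \<longleftrightarrow> integral_image (Suc n) A x) \<and> (\<forall>i<n. B $$ (i, n) = 0)"
  using assms
proof (induction "\<Sum>i<Suc n. nat \<bar>A $$ (i, n)\<bar>" arbitrary: A rule: less_induct)
  case less
  note A = less.prems
  \<comment> \<open>Either the column is already cleared above its last entry, or its only nonzero
    entry has to be swapped into the last row, or two nonzero entries allow a Euclidean
    step.\<close>
  consider "\<forall>i<n. A $$ (i, n) = 0"
    | i where "i < n" "A $$ (i, n) \<noteq> 0" "\<forall>j<Suc n. j \<noteq> i \<longrightarrow> A $$ (j, n) = 0"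
    | i j where "i < Suc n" "j < Suc n" "i \<noteq> j" "A $$ (i, n) \<noteq> 0" "A $$ (j, n) \<noteq> 0"
    by (metis less_Suc_eq)
  thus ?case
  proof cases
    case 1
    thus ?thesis using A by blast
  next
    case 2
    let ?B = "swaprows i n A"
    have "\<bar>det ?B\<bar> = \<bar>det A\<bar>"
      using det_swaprows[of i "Suc n" n A] 2 A by simp
    moreover have "\<forall>j<n. ?B $$ (j, n) = 0"
      using 2 A by auto
    moreover have "integral_image (Suc n) ?B x \<longleftrightarrow> integral_image (Suc n) A x" for x
      using 2 A by (intro integral_image_swaprows) auto
    ultimately show ?thesis using A by (intro exI[of _ ?B]) auto
  next
    case (3 i j)
    then obtain k l where kl: "k < Suc n" "l < Suc n" "k \<noteq> l" "A $$ (l, n) \<noteq> 0"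
        "\<bar>A $$ (l, n)\<bar> \<le> \<bar>A $$ (k, n)\<bar>"
      by (metis linorder_le_cases)
    \<comment> \<open>With this sign the entry of row \<open>k\<close> moves towards zero by the
      absolute value of the entry of row \<open>l\<close>. As that value is nonzero and no larger,
      the sum of absolute values drops.\<close>
    define a where "a = - (sgn (A $$ (k, n)) * sgn (A $$ (l, n)))"
    let ?B = "addrow a k l A"
    have B: "?B \<in> carrier_mat (Suc n) (Suc n)" using A by simp
    have "\<bar>?B $$ (k, n)\<bar> < \<bar>A $$ (k, n)\<bar>"
      using kl A by (auto simp: a_def sgn_if abs_if split: if_splits)
    hence "(\<Sum>i<Suc n. nat \<bar>?B $$ (i, n)\<bar>) < (\<Sum>i<Suc n. nat \<bar>A $$ (i, n)\<bar>)"
      using kl A by (intro sum_strict_mono_ex1) auto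
    from less.hyps[OF this B] obtain C where C: "C \<in> carrier_mat (Suc n) (Suc n)"
      "\<bar>det C\<bar> = \<bar>det ?B\<bar>" "\<forall>x. integral_image (Suc n) C x \<longleftrightarrow> integral_image (Suc n) ?B x"
      "\<forall>i<n. C $$ (i, n) = 0" by blast
    have "det ?B = det A" using kl A by (intro det_addrow) auto
    moreover have "integral_image (Suc n) ?B x \<longleftrightarrow> integral_image (Suc n) A x" for x
      using kl A by (intro integral_image_addrow) auto
    ultimately show ?thesis using C by (intro exI[of _ C]) auto
  qed
qed

lemma p_part_mult:
  assumes "prime p" "a > 0" "b > 0"
  shows "p_part p (a * b) = p_part p a * p_part p b"
  using assms prime_elem_multiplicity_mult_distrib[of p a b] prime_imp_prime_elem[of p]
  by (simp add: p_part_def power_add)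

text \<open>
  The kernel of \<open>A\<close> on the \<open>p\<close>-primary part of the torus \<open>\<rat>\<^sup>n / \<int>\<^sup>n\<close>.
\<close>

lemma card_torsion_kernel:
  assumes p: "prime p" and "A \<in> carrier_mat n n" "det A \<noteq> 0"
  shows "finite {x \<in> {..<n} \<rightarrow>\<^sub>E unit_p_fractions p. integral_image n A x} \<and>
    card {x \<in> {..<n} \<rightarrow>\<^sub>E unit_p_fractions p. integral_image n A x} = p_part p (nat \<bar>det A\<bar>)"
  using assms(2,3)
proof (induction n arbitrary: A)
  case 0
  hence "det A = 1" by (simp add: det_dim_zero)
  moreover have "{x \<in> {..<0::nat} \<rightarrow>\<^sub>E unit_p_fractions p. integral_image 0 A x} = {\<lambda>_. undefined}"
    by (auto simp: integral_image_def)
  ultimately show ?case by (simp add: p_part_def)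
next
  case (Suc n)
  let ?U = "unit_p_fractions p"
  obtain B where B: "B \<in> carrier_mat (Suc n) (Suc n)" "\<bar>det B\<bar> = \<bar>det A\<bar>"
    "\<And>x. integral_image (Suc n) B x \<longleftrightarrow> integral_image (Suc n) A x" "\<And>i. i < n \<Longrightarrow> B $$ (i, n) = 0"
    using clear_last_column[OF Suc.prems(1)] by blast
  \<comment> \<open>The last column of \<open>B\<close> vanishes above the corner \<open>c\<close>,
    so the first \<open>n\<close> conditions involve only the first \<open>n\<close> coordinates and
    are those of \<open>B'\<close>.\<close>
  define B' where "B' = mat_delete B n n"
  define c where "c = B $$ (n, n)"
  have B'c: "B' \<in> carrier_mat n n"
    unfolding B'_def using B(1) by (auto simp: mat_delete_def)
  have B'i: "B' $$ (i, j) = B $$ (i, j)" if "i < n" "j < n" for i j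
    unfolding B'_def using B(1) that by (auto simp: mat_delete_def)
  have "det B = (\<Sum>i<Suc n. B $$ (i, n) * cofactor B i n)"
    using B(1) by (intro laplace_expansion_column) auto
  also have "\<dots> = c * det B'"
    using B(4) by (simp add: c_def cofactor_def B'_def)
  finally have detB: "det B = c * det B'" .
  have "det B \<noteq> 0" using B(2) Suc.prems(2) by auto
  hence c0: "c \<noteq> 0" and d0: "det B' \<noteq> 0" using detB by auto
  define K where "K = {x \<in> {..<n} \<rightarrow>\<^sub>E ?U. integral_image n B' x}"
  have K: "finite K" "card K = p_part p (nat \<bar>det B'\<bar>)"
    using Suc.IH[OF B'c d0] by (simp_all add: K_def)
  \<comment> \<open>For fixed first coordinates \<open>x\<close>, the last row is one linear
    congruence in the last coordinate, with constant term \<open>t x\<close> and solution set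
    \<open>Y x\<close>.\<close>
  define t where "t = (\<lambda>x. \<Sum>j<n. of_int (B $$ (n, j)) * x j :: rat)"
  define Y where "Y = (\<lambda>x. {y \<in> ?U. of_int c * y + t x \<in> \<int>})"
  \<comment> \<open>A common power of p clears all denominators, so
    \<open>card_linear_congruence\<close> applies to \<open>t x\<close>.\<close>
  have tK: "\<exists>k. of_nat p ^ k * t x \<in> \<int>" if "x \<in> K" for x
  proof -
    have "\<forall>j<n. \<exists>k. of_nat p ^ k * x j \<in> \<int>"
      using that by (auto simp: K_def PiE_iff unit_p_fractions_def)
    then obtain k where k: "\<And>j. j < n \<Longrightarrow> of_nat p ^ k j * x j \<in> \<int>" by metis
    define N where "N = (\<Sum>j<n. k j)"
    have kN: "k j \<le> N" if "j < n" for j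
      unfolding N_def using that by (intro member_le_sum) auto
    have "of_nat p ^ N * t x = (\<Sum>j<n. of_int (B $$ (n, j)) * (of_nat p ^ (N - k j) * (of_nat p ^ k j * x j)))"
      unfolding t_def sum_distrib_left
    proof (rule sum.cong)
      fix j assume "j \<in> {..<n}"
      hence "(of_nat p :: rat) ^ N = of_nat p ^ (N - k j) * of_nat p ^ k j"
        using kN by (simp flip: power_add)
      thus "of_nat p ^ N * (of_int (B $$ (n, j)) * x j) =
          of_int (B $$ (n, j)) * (of_nat p ^ (N - k j) * (of_nat p ^ k j * x j))"
        by (simp add: mult_ac)
    qed simp
    also have "\<dots> \<in> \<int>"
      by (intro Ints_sum Ints_mult[OF Ints_of_int] Ints_mult[OF Ints_power[OF Ints_of_nat]] k) auto
    finally show ?thesis by blast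
  qed
  have Y: "finite (Y x)" "card (Y x) = p_part p (nat \<bar>c\<bar>)" if "x \<in> K" for x
    using tK[OF that] card_linear_congruence[OF p c0] by (auto simp: Y_def)
  have split: "integral_image (Suc n) B x \<longleftrightarrow> integral_image n B' x \<and> of_int c * x n + t x \<in> \<int>" for x
    using B(4) by (auto simp: integral_image_def less_Suc_eq B'i c_def t_def add.commute)
  have restr: "integral_image n B' (restrict x {..<n}) \<longleftrightarrow> integral_image n B' x"
    "t (restrict x {..<n}) = t x" for x
    by (auto simp: integral_image_def t_def)
  have upd: "integral_image n B' (x(n := y)) \<longleftrightarrow> integral_image n B' x"
    "t (x(n := y)) = t x" for x y
    by (auto simp: integral_image_def t_def)
  \<comment> \<open>The kernel of \<open>B\<close> fibres over the kernel \<open>K\<close> of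
    \<open>B'\<close>, and all fibres have the size of the p-part of \<open>c\<close>. The two
    p-parts multiply to that of the determinant.\<close>
  have "bij_betw (\<lambda>(x, y). x(n := y)) (Sigma K Y)
      {x \<in> {..<Suc n} \<rightarrow>\<^sub>E ?U. integral_image (Suc n) B x}"
  proof (rule bij_betw_byWitness[where f' = "\<lambda>x. (restrict x {..<n}, x n)"])
    show "\<forall>z\<in>Sigma K Y. (restrict (case z of (x, y) \<Rightarrow> x(n := y)) {..<n}, (case z of (x, y) \<Rightarrow> x(n := y)) n) = z"
      by (auto simp: K_def fun_eq_iff PiE_iff extensional_def)
    show "\<forall>x\<in>{x \<in> {..<Suc n} \<rightarrow>\<^sub>E ?U. integral_image (Suc n) B x}.
        (case (restrict x {..<n}, x n) of (x, y) \<Rightarrow> x(n := y)) = x"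
      by (auto simp: fun_eq_iff PiE_iff extensional_def)
    show "(\<lambda>(x, y). x(n := y)) ` Sigma K Y \<subseteq> {x \<in> {..<Suc n} \<rightarrow>\<^sub>E ?U. integral_image (Suc n) B x}"
      by (auto simp: split upd K_def Y_def PiE_iff extensional_def less_Suc_eq)
    show "(\<lambda>x. (restrict x {..<n}, x n)) ` {x \<in> {..<Suc n} \<rightarrow>\<^sub>E ?U. integral_image (Suc n) B x} \<subseteq> Sigma K Y"
      by (auto simp: split restr K_def Y_def PiE_iff)
  qed
  from bij_betw_finite[OF this] bij_betw_same_card[OF this]
  have *: "finite {x \<in> {..<Suc n} \<rightarrow>\<^sub>E ?U. integral_image (Suc n) B x} \<longleftrightarrow> finite (Sigma K Y)"
    "card {x \<in> {..<Suc n} \<rightarrow>\<^sub>E ?U. integral_image (Suc n) B x} = card (Sigma K Y)" by simp_all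
  have "finite (Sigma K Y)" using K Y by (intro finite_SigmaI) auto
  moreover have "card (Sigma K Y) = card K * p_part p (nat \<bar>c\<bar>)"
    using K Y by simp
  moreover have "\<dots> = p_part p (nat \<bar>det A\<bar>)"
    using c0 d0 p by (simp add: K p_part_mult[symmetric] flip: B(2))
      (simp add: detB abs_mult nat_mult_distrib mult.commute)
  ultimately show ?case using * by (simp add: B(3))
qed

section \<open>Circulant matrices\<close>

text \<open>Row \<open>i\<close> is the recurrence at position \<open>i\<close>, read on a sequence
  of period \<open>n\<close>. Coefficients whose indices agree modulo \<open>n\<close> are added up,
  which covers the case that \<open>n\<close> is at most the degree.\<close>

definition circulant :: "nat \<Rightarrow> int poly \<Rightarrow> int mat" where
  "circulant n f = mat n n (\<lambda>(i, j). \<Sum>k | k \<le> degree f \<and> (i + k) mod n = j. Polynomial.coeff f k)"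

lemma circulant_carrier [simp]: "circulant n f \<in> carrier_mat n n"
  by (simp add: circulant_def)

text \<open>Regroup the coefficients by the residue of i + k. The ring is left general because the
  rationals are needed for torsion points and the complex numbers for eigenvectors.\<close>

lemma circulant_apply:
  fixes x :: "nat \<Rightarrow> 'a :: comm_ring_1"
  assumes "i < n"
  shows "(\<Sum>j<n. of_int (circulant n f $$ (i, j)) * x j) =
    (\<Sum>k\<le>degree f. of_int (Polynomial.coeff f k) * x ((i + k) mod n))"
proof -
  have "(\<Sum>k\<le>degree f. of_int (Polynomial.coeff f k) * x ((i + k) mod n)) =
      (\<Sum>j<n. \<Sum>k | k \<in> {..degree f} \<and> (i + k) mod n = j. of_int (Polynomial.coeff f k) * x ((i + k) mod n))"
    using assms by (intro sum.group [symmetric]) auto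
  also have "\<dots> = (\<Sum>j<n. of_int (circulant n f $$ (i, j)) * x j)"
    using assms by (intro sum.cong) (auto simp: circulant_def sum_distrib_right)
  finally show ?thesis by simp
qed

lemma sum_powers_root_of_unity:
  fixes z :: complex
  assumes "z ^ n = 1" "z \<noteq> 1"
  shows "(\<Sum>l<n. z ^ l) = 0"
  using assms by (simp add: sum_gp_strict)

text \<open>As polynomials in z both sides are monic of degree n. Their difference would have degree
  below n but vanish at all n roots of unity, so it is zero.\<close>

lemma prod_diff_roots_of_unity:
  fixes z :: complex
  assumes n: "n > 0"
  shows "(\<Prod>l<n. z - cis (2 * pi * real l / real n)) = z ^ n - 1"
proof -
  let ?w = "\<lambda>l. cis (2 * pi * real l / real n)"
  let ?P = "\<Prod>l<n. [:- ?w l, 1:]" and ?Q = "Polynomial.monom 1 n - 1 :: complex poly"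
  have bij: "bij_betw ?w {..<n} {z. z ^ n = 1}" using n by (rule bij_betw_roots_unity)
  have degQ: "degree ?Q = n"
    using n degree_add_eq_left[of "- 1" "Polynomial.monom 1 n :: complex poly"]
    by (simp add: degree_monom_eq)
  have Q0: "?Q \<noteq> 0" using degQ n by auto
  have cQ: "Polynomial.coeff ?Q n = 1" using n by simp
  have degP: "degree ?P = n" by (subst degree_prod_eq_sum_degree) auto
  have cP: "lead_coeff ?P = 1" by (simp add: lead_coeff_prod)
  have "?P = ?Q"
  proof (rule ccontr)
    assume "?P \<noteq> ?Q"
    hence D0: "?P - ?Q \<noteq> 0" by simp
    have "Polynomial.coeff (?P - ?Q) n = 0" using cP cQ degP by simp
    moreover have "degree (?P - ?Q) \<le> n" using degP degQ by (simp only: degree_diff_le)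
    ultimately have "degree (?P - ?Q) < n"
      using D0 n by (metis le_neq_implies_less leading_coeff_0_iff)
    moreover have "{z. z ^ n = 1} \<subseteq> {z. poly (?P - ?Q) z = 0}"
    proof
      fix z :: complex assume "z \<in> {z. z ^ n = 1}"
      moreover from this obtain l where "l < n" "z = ?w l"
        using bij by (auto simp: bij_betw_def)
      ultimately show "z \<in> {z. poly (?P - ?Q) z = 0}"
        by (auto simp: poly_prod poly_monom intro!: prod_zero)
    qed
    hence "card {z :: complex. z ^ n = 1} \<le> card {z. poly (?P - ?Q) z = 0}"
      using D0 by (intro card_mono poly_roots_finite)
    hence "n \<le> card {z. poly (?P - ?Q) z = 0}"
      using card_roots_unity_eq[OF n] by simp
    moreover have "card {z. poly (?P - ?Q) z = 0} \<le> degree (?P - ?Q)"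
      using D0 by (rule card_poly_roots_bound)
    ultimately show False by linarith
  qed
  hence "poly ?P z = poly ?Q z" by simp
  thus ?thesis by (simp add: poly_prod poly_monom algebra_simps)
qed

text \<open>The discrete Fourier matrix diagonalises every circulant matrix.\<close>

lemma det_circulant:
  assumes n: "n > 0"
  shows "of_int (det (circulant n f)) =
    (\<Prod>l<n. poly (map_poly of_int f) (cis (2 * pi * real l / real n)))"
proof -
  define w where "w = cis (2 * pi / real n)"
  have wl: "cis (2 * pi * real l / real n) = w ^ l" for l
    by (simp add: w_def DeMoivre mult_ac)
  have wn: "w ^ n = 1" using n by (simp add: w_def DeMoivre)
  have w0: "w \<noteq> 0" by (simp add: w_def)
  have w1: "w ^ l \<noteq> 1" if "0 < l" "l < n" for l
  proof
    assume "w ^ l = 1"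
    moreover have "inj_on (\<lambda>l. cis (2 * pi * real l / real n)) {..<n}"
      using bij_betw_roots_unity[OF n] by (simp add: bij_betw_def)
    ultimately show False using that n unfolding wl inj_on_def by (metis lessThan_iff less_irrefl power_0)
  qed
  have wmod: "w ^ (m mod n) = w ^ m" for m
    by (metis wn mod_mult_div_eq mult_1_right power_add power_mult power_one)
  define F where "F = mat n n (\<lambda>(j, l). w ^ (j * l))"
  \<comment> \<open>Up to the factor n this is the inverse of \<open>F\<close>; it serves to show
    that \<open>det F\<close> is nonzero.\<close>
  define G where "G = mat n n (\<lambda>(l, j). inverse w ^ (j * l))"
  define E where "E = mat n n (\<lambda>(i, l). if i = l then poly (map_poly of_int f) (w ^ l) else 0)"
  define C where "C = map_mat (of_int :: int \<Rightarrow> complex) (circulant n f)"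
  have car: "F \<in> carrier_mat n n" "G \<in> carrier_mat n n" "E \<in> carrier_mat n n" "C \<in> carrier_mat n n"
    by (simp_all add: F_def G_def E_def C_def)
  have "F * G = of_nat n \<cdot>\<^sub>m 1\<^sub>m n"
  proof (rule eq_matI)
    fix i j assume "i < dim_row (of_nat n \<cdot>\<^sub>m 1\<^sub>m n :: complex mat)" "j < dim_col (of_nat n \<cdot>\<^sub>m 1\<^sub>m n :: complex mat)"
    hence ij: "i < n" "j < n" by auto
    have "(F * G) $$ (i, j) = (\<Sum>l<n. w ^ (i * l) * inverse w ^ (j * l))"
      using ij by (simp add: F_def G_def scalar_prod_def atLeast0LessThan)
    also have "\<dots> = (\<Sum>l<n. (w ^ i * inverse w ^ j) ^ l)"
      by (simp add: power_mult power_mult_distrib)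
    \<comment> \<open>This is a geometric sum whose ratio is an n-th root of unity, equal to 1 only
      on the diagonal.\<close>
    also have "\<dots> = (if i = j then of_nat n else 0)"
    proof (cases "i = j")
      case True
      thus ?thesis using w0 by (simp flip: power_mult_distrib)
    next
      case False
      have "(w ^ i * inverse w ^ j) ^ n = 1"
        using wn by (simp add: power_mult_distrib power_inverse flip: power_mult)
           (simp add: mult.commute[of _ n] power_mult wn)
      moreover have "w ^ i * inverse w ^ j \<noteq> 1"
      proof
        assume "w ^ i * inverse w ^ j = 1"
        hence eq: "w ^ i = w ^ j" using w0 by (simp add: power_inverse field_simps)
        show False
        proof (cases "i < j")
          case True
          hence "w ^ (j - i) = 1" using eq w0 by (simp add: power_diff)
          thus False using w1[of "j - i"] True ij by simp
        next
          case False
          hence "w ^ (i - j) = 1" using eq w0 by (simp add: power_diff)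
          thus False using w1[of "i - j"] False \<open>i \<noteq> j\<close> ij by simp
        qed
      qed
      ultimately show ?thesis using False by (simp add: sum_powers_root_of_unity)
    qed
    finally show "(F * G) $$ (i, j) = (of_nat n \<cdot>\<^sub>m 1\<^sub>m n) $$ (i, j)"
      using ij by simp
  qed (simp_all add: F_def G_def)
  hence "det F * det G = of_nat n ^ n"
    using det_mult[OF car(1,2)] by simp
  hence F0: "det F \<noteq> 0" using n by auto
  \<comment> \<open>Column \<open>l\<close> of \<open>F\<close> is an eigenvector of
    \<open>C\<close>: a cyclic shift multiplies it by \<open>w ^ l\<close>, so the recurrence
    multiplies it by the value of f there.\<close>
  have "C * F = F * E"
  proof (rule eq_matI)
    fix i l assume "i < dim_row (F * E)" "l < dim_col (F * E)"
    hence il: "i < n" "l < n" using car by auto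
    have "(C * F) $$ (i, l) = (\<Sum>j<n. of_int (circulant n f $$ (i, j)) * w ^ (j * l))"
      using il by (simp add: C_def F_def scalar_prod_def atLeast0LessThan carrier_matD[OF circulant_carrier])
    also have "\<dots> = (\<Sum>k\<le>degree f. of_int (Polynomial.coeff f k) * w ^ ((i + k) mod n * l))"
      using il(1) by (rule circulant_apply)
    also have "\<dots> = (\<Sum>k\<le>degree f. of_int (Polynomial.coeff f k) * (w ^ (i * l) * (w ^ l) ^ k))"
    proof (intro sum.cong refl arg_cong2[where f = "(*)"])
      fix k
      have "w ^ ((i + k) mod n * l) = (w ^ ((i + k) mod n)) ^ l" by (simp add: power_mult)
      also have "\<dots> = w ^ (i * l) * (w ^ l) ^ k"
        unfolding wmod by (simp add: algebra_simps flip: power_mult power_add)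
      finally show "w ^ ((i + k) mod n * l) = w ^ (i * l) * (w ^ l) ^ k" .
    qed
    also have "\<dots> = w ^ (i * l) * poly (map_poly of_int f) (w ^ l)"
      by (simp add: poly_altdef sum_distrib_left degree_map_poly coeff_map_poly mult_ac)
    also have "\<dots> = (F * E) $$ (i, l)"
      using il by (simp add: F_def E_def scalar_prod_def if_distrib sum.delta cong: if_cong)
    finally show "(C * F) $$ (i, l) = (F * E) $$ (i, l)" .
  qed (use car in auto)
  hence "det C * det F = det F * det E"
    by (metis det_mult[OF car(4,1)] det_mult[OF car(1,3)])
  hence "det C = det E" using F0 by simp
  also have "\<dots> = (\<Prod>l<n. poly (map_poly of_int f) (w ^ l))"
    using det_lower_triangular[OF _ car(3)] by (simp add: E_def prod_list_diag_prod atLeast0LessThan)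
  also have "det C = of_int (det (circulant n f))"
    unfolding C_def by (rule of_int_hom.hom_det)
  finally show ?thesis by (simp add: wl)
qed

text \<open>Both sides are the absolute value of the resultant of f and x^n - 1. Factoring f over
  its roots turns \<open>det_circulant\<close> into a double product over roots of f and roots of
  unity; taking the roots of unity first gives the factors of \<open>Delta\<close>.\<close>

lemma abs_det_circulant:
  assumes monic: "lead_coeff f = 1" and n: "n > 0"
  shows "real_of_int \<bar>det (circulant n f)\<bar> = Delta f n"
proof -
  let ?f = "map_poly (of_int :: int \<Rightarrow> complex) f"
  let ?w = "\<lambda>l. cis (2 * pi * real l / real n)"
  have "lead_coeff ?f = 1" using monic by (simp add: degree_map_poly coeff_map_poly)
  hence f: "?f = (\<Prod>\<alpha>\<in>#complex_roots f. [:- \<alpha>, 1:])"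
    using complex_poly_decompose_multiset[of ?f] by (simp add: complex_roots_def)
  have pf: "poly ?f z = (\<Prod>\<alpha>\<in>#complex_roots f. z - \<alpha>)" for z
    by (subst f) (simp add: poly_prod_mset image_mset.compositionality o_def)
  have "real_of_int \<bar>det (circulant n f)\<bar> = norm (of_int (det (circulant n f)) :: complex)"
    by simp
  also have "\<dots> = (\<Prod>l<n. norm (poly ?f (?w l)))"
    unfolding det_circulant[OF n] by (simp add: prod_norm)
  also have "\<dots> = (\<Prod>l<n. \<Prod>\<alpha>\<in>#complex_roots f. norm (\<alpha> - ?w l))"
  proof (rule prod.cong)
    fix l
    have "norm (\<Prod>\<alpha>\<in>#M. ?w l - \<alpha>) = (\<Prod>\<alpha>\<in>#M. norm (\<alpha> - ?w l))" for M
      by (induction M) (simp_all add: norm_mult norm_minus_commute)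
    thus "norm (poly ?f (?w l)) = (\<Prod>\<alpha>\<in>#complex_roots f. norm (\<alpha> - ?w l))"
      by (simp add: pf)
  qed simp
  also have "\<dots> = (\<Prod>\<alpha>\<in>#complex_roots f. \<Prod>l<n. norm (\<alpha> - ?w l))"
  proof -
    have "(\<Prod>l<n. \<Prod>\<alpha>\<in>#M. norm (\<alpha> - ?w l)) = (\<Prod>\<alpha>\<in>#M. \<Prod>l<n. norm (\<alpha> - ?w l))" for M
      by (induction M) (simp_all add: prod.distrib)
    thus ?thesis .
  qed
  also have "\<dots> = Delta f n"
    unfolding Delta_def prod_norm prod_diff_roots_of_unity[OF n] ..
  finally show ?thesis .
qed

section \<open>Denominators of Bernoulli numbers\<close>

definition p_integral :: "nat \<Rightarrow> rat \<Rightarrow> bool" where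
  "p_integral p r \<longleftrightarrow> (\<exists>a b :: int. \<not> int p dvd b \<and> r = of_int a / of_int b)"

lemma p_integralI: "\<not> int p dvd b \<Longrightarrow> p_integral p (of_int a / of_int b)"
  by (auto simp: p_integral_def)

lemma p_integral_of_int [simp]:
  assumes "prime p"
  shows "p_integral p (of_int a)"
  using p_integralI[of p 1 a] prime_gt_1_nat[OF assms] by simp

lemma p_integral_0 [simp]: "prime p \<Longrightarrow> p_integral p 0"
  using p_integral_of_int[of p 0] by simp

lemma p_integral_of_nat [simp]: "prime p \<Longrightarrow> p_integral p (of_nat a)"
  using p_integral_of_int[of p "int a"] by simp

lemma p_integral_add:
  assumes "prime p" "p_integral p x" "p_integral p y"
  shows "p_integral p (x + y)"
proof -
  obtain a b c d where *: "\<not> int p dvd b" "x = of_int a / of_int b"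
      "\<not> int p dvd d" "y = of_int c / of_int d"
    using assms by (auto simp: p_integral_def)
  from * have "b \<noteq> 0" "d \<noteq> 0" by auto
  hence "x + y = of_int (a * d + c * b) / of_int (b * d)"
    using * by (simp add: field_simps)
  moreover have "\<not> int p dvd b * d"
    using * assms(1) by (simp add: prime_dvd_mult_iff)
  ultimately show ?thesis by (metis p_integralI)
qed

lemma p_integral_mult:
  assumes "prime p" "p_integral p x" "p_integral p y"
  shows "p_integral p (x * y)"
proof -
  obtain a b c d where *: "\<not> int p dvd b" "x = of_int a / of_int b"
      "\<not> int p dvd d" "y = of_int c / of_int d"
    using assms by (auto simp: p_integral_def)
  have "x * y = of_int (a * c) / of_int (b * d)"
    using * by simp
  moreover have "\<not> int p dvd b * d"
    using * assms(1) by (simp add: prime_dvd_mult_iff)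
  ultimately show ?thesis by (metis p_integralI)
qed

lemma p_integral_uminus:
  assumes "prime p" "p_integral p x"
  shows "p_integral p (- x)"
  using p_integral_mult[OF assms(1) p_integral_of_int[OF assms(1), of "-1"] assms(2)] by simp

lemma p_integral_diff:
  assumes "prime p" "p_integral p x" "p_integral p y"
  shows "p_integral p (x - y)"
  using p_integral_add[OF assms(1,2) p_integral_uminus[OF assms(1,3)]] by simp

lemma p_integral_sum:
  assumes "prime p" "\<And>i. i \<in> I \<Longrightarrow> p_integral p (f i)"
  shows "p_integral p (sum f I)"
  using assms(2)
  by (induction I rule: infinite_finite_induct) (auto simp: assms(1) intro: p_integral_add)

text \<open>Cross-multiply with a fraction whose denominator is prime to p: if p divided the reduced
  denominator, it would also divide the reduced numerator.\<close>

lemma p_integral_iff_not_dvd_denom: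
  assumes "prime p"
  shows "p_integral p r \<longleftrightarrow> \<not> int p dvd snd (quotient_of r)"
proof
  obtain a b where q: "quotient_of r = (a, b)" by force
  have r: "r = of_int a / of_int b" and b: "b > 0" and cop: "coprime a b"
    using q by (auto simp: quotient_of_div quotient_of_denom_pos quotient_of_coprime)
  {
    assume "p_integral p r"
    then obtain c d where cd: "\<not> int p dvd d" "r = of_int c / of_int d"
      by (auto simp: p_integral_def)
    hence "d \<noteq> 0" by auto
    hence "(of_int (a * d) :: rat) = of_int (c * b)"
      using cd b r by (simp add: field_simps)
    hence *: "a * d = c * b" by linarith
    show "\<not> int p dvd snd (quotient_of r)"
    proof
      assume "int p dvd snd (quotient_of r)"
      hence pb: "int p dvd b" by (simp add: q)
      hence "int p dvd a * d" unfolding * by simp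
      hence "int p dvd a" using cd assms by (simp add: prime_dvd_mult_iff)
      with pb cop have "is_unit (int p)" by (meson coprime_common_divisor)
      thus False using assms by simp
    qed
  }
  show "\<not> int p dvd snd (quotient_of r) \<Longrightarrow> p_integral p r"
    unfolding q by (metis p_integralI r snd_conv)
qed

section \<open>Power sums and the von Staudt-Clausen theorem\<close>

lemma power_sum_recurrence:
  fixes N m :: nat
  shows "(\<Sum>k<N. of_nat k ^ m :: rat) =
    (\<Sum>j\<le>m. of_nat (m choose j) * bernoulli (m - j) * of_nat N ^ Suc j / of_nat (Suc j))"
proof -
  define B where "B = Abs_fps (\<lambda>m. bernoulli m / fact m)"
  have gen: "(fps_exp 1 - 1) * B = fps_X"
    unfolding B_def by (rule bernoulli_generating_function)
  \<comment> \<open>The geometric series of exponentials telescopes; multiplying by \<open>B\<close>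
    then trades the factor e^t - 1 for t.\<close>
  have E: "(\<Sum>k<N. fps_exp (of_nat k :: rat)) * (fps_exp 1 - 1) = fps_exp (of_nat N) - 1"
    by (induction N) (simp_all add: algebra_simps fps_exp_add_mult)
  have "(\<Sum>k<N. fps_exp (of_nat k :: rat)) * fps_X =
      (\<Sum>k<N. fps_exp (of_nat k :: rat)) * (fps_exp 1 - 1) * B"
    by (simp only: gen [symmetric] mult.assoc)
  also have "\<dots> = B * (fps_exp (of_nat N) - 1)"
    unfolding E by (simp add: mult.commute)
  finally have eq: "(\<Sum>k<N. fps_exp (of_nat k :: rat)) * fps_X = B * (fps_exp (of_nat N) - 1)" .
  \<comment> \<open>The factor t shifts the index, so coefficients are compared at m + 1. On the
    other side the top Bernoulli term drops out because e^(Nt) - 1 has no constant term.\<close>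
  have "(\<Sum>k<N. of_nat k ^ m / fact m :: rat) =
      fps_nth ((\<Sum>k<N. fps_exp (of_nat k :: rat)) * fps_X) (Suc m)"
    by (simp add: fps_sum_nth)
  also have "\<dots> =
      (\<Sum>i\<le>m. bernoulli i / fact i * (of_nat N ^ (Suc m - i) / fact (Suc m - i)))"
    unfolding eq by (simp add: fps_mult_nth B_def atLeast0AtMost) (simp only: mult.commute)
  also have "\<dots> = (\<Sum>j\<le>m. bernoulli (m - j) / fact (m - j) * (of_nat N ^ Suc j / fact (Suc j)))"
    by (rule sum.reindex_bij_witness[of _ "\<lambda>j. m - j" "\<lambda>j. m - j"]) (auto simp: Suc_diff_le)
  finally have eq': "(\<Sum>k<N. of_nat k ^ m / fact m :: rat) =
      (\<Sum>j\<le>m. bernoulli (m - j) / fact (m - j) * (of_nat N ^ Suc j / fact (Suc j)))" .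
  have "(\<Sum>k<N. of_nat k ^ m :: rat) = fact m * (\<Sum>k<N. of_nat k ^ m / fact m)"
    by (simp add: sum_distrib_left)
  also have "\<dots> = (\<Sum>j\<le>m. of_nat (m choose j) * bernoulli (m - j) * of_nat N ^ Suc j / of_nat (Suc j))"
    unfolding eq' sum_distrib_left
  proof (rule sum.cong)
    fix j assume "j \<in> {..m}"
    hence "of_nat (m choose j) = (fact m / (fact j * fact (m - j)) :: rat)"
      by (simp add: binomial_fact)
    moreover have "fact (Suc j) = (of_nat (Suc j) * fact j :: rat)"
      by simp
    ultimately show "fact m * (bernoulli (m - j) / fact (m - j) * (of_nat N ^ Suc j / fact (Suc j))) =
        of_nat (m choose j) * bernoulli (m - j) * of_nat N ^ Suc j / of_nat (Suc j)"
      by (simp only: times_divide_times_eq times_divide_eq_left times_divide_eq_right divide_divide_eq_left mult_ac)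
  qed simp
  finally show ?thesis .
qed

text \<open>Let v be the exponent of p in j + 1. From 2^v <= j + 1 follows v <= j. For j >= 1,
  equality would force p^j <= j + 1, which happens only for p = 2 and j = 1.\<close>

lemma prime_power_over_Suc:
  fixes p j :: nat
  assumes "prime p"
  shows "p_integral p (of_nat p ^ j / of_nat (Suc j))"
    and "j \<ge> 1 \<Longrightarrow> p \<noteq> 2 \<or> j \<noteq> 1 \<Longrightarrow> p_integral p (of_nat p ^ (j - 1) / of_nat (Suc j))"
proof -
  define v where "v = multiplicity p (Suc j)"
  have p: "p \<ge> 2" using assms by (rule prime_ge_2_nat)
  have "\<not> is_unit p" using p by auto
  then obtain s where s: "Suc j = p ^ v * s" "\<not> p dvd s"
    unfolding v_def by (metis multiplicity_decompose' nat.distinct(1))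
  hence s0: "s > 0" by (cases s) auto
  have "2 ^ v \<le> p ^ v" using p by (simp add: power_mono)
  also have "\<dots> \<le> Suc j" using s s0 by simp
  finally have le: "2 ^ v \<le> Suc j" .
  have gen: "p_integral p (of_nat p ^ i / of_nat (Suc j))" if "v \<le> i" for i
  proof -
    have "(of_nat p ^ i / of_nat (Suc j) :: rat) = of_nat p ^ v * of_nat p ^ (i - v) / (of_nat p ^ v * of_nat s)"
      using that by (simp only: s(1) power_add [symmetric] of_nat_mult of_nat_power le_add_diff_inverse)
    also have "\<dots> = of_int (int p ^ (i - v)) / of_int (int s)"
      using p by simp
    finally show ?thesis
      using s(2) by (metis p_integralI int_dvd_int_iff)
  qed
  have "v < 2 ^ v" by simp
  with le have "v \<le> j" by linarith
  thus "p_integral p (of_nat p ^ j / of_nat (Suc j))" by (rule gen)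
  assume j: "j \<ge> 1" "p \<noteq> 2 \<or> j \<noteq> 1"
  have "v \<noteq> j"
  proof
    assume vj: "v = j"
    have "p ^ j \<le> Suc j" using s s0 vj by simp
    moreover have "Suc j < p ^ j" if "p > 2"
    proof -
      have "Suc i < 3 ^ i" if "i \<ge> 1" for i :: nat
        using that by (induction i rule: dec_induct) auto
      moreover have "3 ^ j \<le> p ^ j" using that by (simp add: power_mono)
      ultimately show ?thesis using j(1) by (meson less_le_trans)
    qed
    moreover have "Suc j < 2 ^ j" if "j \<ge> 2"
      using that by (induction j rule: dec_induct) auto
    ultimately show False using j p by (cases "p = 2") auto
  qed
  with \<open>v \<le> j\<close> show "p_integral p (of_nat p ^ (j - 1) / of_nat (Suc j))"
    by (intro gen) auto
qed

text \<open>A primitive root g turns the sum over nonzero residues into a geometric sum with ratio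
  g^m and p - 1 terms. If p - 1 divides m, every term is 1; otherwise the ratio differs from 1 while
  its (p - 1)-th power is 1, so the sum vanishes modulo p.\<close>

lemma power_sum_mod_prime:
  fixes p m :: nat
  assumes "prime p" "m \<ge> 1"
  shows "[(\<Sum>k<p. int k ^ m) = (if (p - 1) dvd m then - 1 else 0)] (mod int p)"
proof -
  have p: "p \<ge> 2" using assms(1) by (rule prime_ge_2_nat)
  obtain g where g: "residue_primroot p g"
    using prime_primitive_root_exists[OF _ assms(1)] p by auto
  have tot: "totient p = p - 1" using assms(1) by (rule totient_prime)
  have bij: "bij_betw (\<lambda>i. g ^ i mod p) {..<p - 1} (totatives p)"
    using residue_primroot_is_generator[of p g] g p tot by simp
  have totset: "totatives p = {1..<p}"
  proof -
    have "{0<..<p} = {1..<p}" by auto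
    thus ?thesis by (simp only: totatives_prime[OF assms(1)])
  qed
  have ordg: "ord p g = p - 1"
    using g tot by (auto simp: residue_primroot_def)
  \<comment> \<open>The term k = 0 vanishes because m is positive.\<close>
  have "(\<Sum>k<p. int k ^ m) = (\<Sum>k\<in>{1..<p}. int k ^ m)"
    using assms(2) by (intro sum.mono_neutral_right) (auto simp: not_less_eq_eq)
  also have "\<dots> = (\<Sum>i<p - 1. int (g ^ i mod p) ^ m)"
    using sum.reindex_bij_betw[OF bij, of "\<lambda>k. int k ^ m"] totset by simp
  finally have eq: "(\<Sum>k<p. int k ^ m) = (\<Sum>i<p - 1. int (g ^ i mod p) ^ m)" .
  have "[(\<Sum>i<p - 1. int (g ^ i mod p) ^ m) = (\<Sum>i<p - 1. (int g ^ m) ^ i)] (mod int p)"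
  proof (rule cong_sum)
    fix i
    have "[int (g ^ i mod p) ^ m = (int g ^ i) ^ m] (mod int p)"
      by (intro cong_pow) (simp add: zmod_int cong_def)
    thus "[int (g ^ i mod p) ^ m = (int g ^ m) ^ i] (mod int p)"
      by (simp add: power_mult [symmetric] mult.commute)
  qed
  hence cong: "[(\<Sum>k<p. int k ^ m) = (\<Sum>i<p - 1. (int g ^ m) ^ i)] (mod int p)"
    by (simp only: eq)
  have ord: "[int g ^ e = 1] (mod int p) \<longleftrightarrow> (p - 1) dvd e" for e
    using ord_divides[of g e p] ordg cong_int_iff[of "g ^ e" 1 p] by simp
  show ?thesis
  proof (cases "(p - 1) dvd m")
    case True
    hence "[(\<Sum>i<p - 1. (int g ^ m) ^ i) = (\<Sum>i<p - 1. 1 ^ i)] (mod int p)"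
      using ord[of m] by (intro cong_sum cong_pow) auto
    also have "(\<Sum>i<p - 1. (1 :: int) ^ i) = int p - 1" using p by simp
    also have "[int p - 1 = - 1] (mod int p)" by (simp add: cong_iff_dvd_diff)
    finally show ?thesis using cong True by (auto intro: cong_trans)
  next
    case False
    have "(int g ^ m - 1) * (\<Sum>i<p - 1. (int g ^ m) ^ i) = (int g ^ m) ^ (p - 1) - 1"
      by (simp add: power_diff_1_eq)
    moreover have "[(int g ^ m) ^ (p - 1) = 1] (mod int p)"
      using ord[of "m * (p - 1)"] by (simp add: power_mult)
    ultimately have "int p dvd (int g ^ m - 1) * (\<Sum>i<p - 1. (int g ^ m) ^ i)"
      by (simp add: cong_iff_dvd_diff)
    moreover have "\<not> int p dvd int g ^ m - 1"
      using ord[of m] False by (simp add: cong_iff_dvd_diff)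
    ultimately have "int p dvd (\<Sum>i<p - 1. (int g ^ m) ^ i)"
      using assms(1) by (simp add: prime_dvd_mult_iff)
    hence "int p dvd (\<Sum>k<p. int k ^ m)"
      using cong cong_dvd_iff by blast
    thus ?thesis using False by (simp add: cong_0_iff)
  qed
qed

text \<open>The power sum formula with N = p, solved for its term j = 0. One factor p stays with
  each Bernoulli number, since these products are the p-integral quantities.\<close>

lemma bernoulli_as_power_sum:
  fixes p m :: nat
  assumes "p > 0"
  shows "of_nat p * bernoulli m = (\<Sum>k<p. of_nat k ^ m) -
    (\<Sum>j\<in>{1..m}. of_nat (m choose j) * (of_nat p * bernoulli (m - j)) * (of_nat p ^ j / of_nat (Suc j)))"
proof -
  have "{..m} = insert 0 {1..m}" by auto
  thus ?thesis
    unfolding power_sum_recurrence by (simp add: mult_ac)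
qed

text \<open>Strong induction: each term with j >= 1 contains p B_(m-j), p-integral by hypothesis,
  and the p-integral factor p^j/(j + 1).\<close>

lemma p_integral_prime_times_bernoulli:
  assumes "prime p"
  shows "p_integral p (of_nat p * bernoulli m)"
proof (induction m rule: less_induct)
  case (less m)
  have S: "p_integral p (\<Sum>k<p. of_nat k ^ m)"
    using p_integral_of_nat[OF assms, of "\<Sum>k<p. k ^ m"] by simp
  have "p_integral p (of_nat (m choose j) * (of_nat p * bernoulli (m - j)) * (of_nat p ^ j / of_nat (Suc j)))"
    if "j \<in> {1..m}" for j
  proof -
    have "p_integral p (of_nat p * bernoulli (m - j))"
      by (rule less.IH) (use that in auto)
    thus ?thesis
      by (rule p_integral_mult[OF assms p_integral_mult[OF assms p_integral_of_nat[OF assms]]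
          prime_power_over_Suc(1)[OF assms]])
  qed
  hence "p_integral p ((\<Sum>k<p. of_nat k ^ m) -
    (\<Sum>j\<in>{1..m}. of_nat (m choose j) * (of_nat p * bernoulli (m - j)) * (of_nat p ^ j / of_nat (Suc j))))"
    by (intro p_integral_diff[OF assms S] p_integral_sum[OF assms])
  thus ?case
    using bernoulli_as_power_sum[of p m] prime_gt_0_nat[OF assms] by simp
qed

text \<open>A factor p can be taken out of every term with j >= 1 without losing p-integrality.
  Hence p B_m is congruent modulo p to the power sum, which is -1 or 0, and dividing by p gives the
  claim.\<close>

theorem von_Staudt_Clausen:
  assumes "prime p" "even m" "m > 0"
  shows "p_integral p (bernoulli m + (if (p - 1) dvd m then 1 / of_nat p else 0))"
proof -
  have p0: "p > 0" using assms(1) by (rule prime_gt_0_nat)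
  define S where "S = (\<Sum>k<p. int k ^ m)"
  define e :: int where "e = (if (p - 1) dvd m then - 1 else 0)"
  have "[S = e] (mod int p)"
    unfolding S_def e_def using assms by (intro power_sum_mod_prime) auto
  then obtain t where "S - e = int p * t"
    by (auto simp: cong_iff_dvd_diff dvd_def)
  hence t: "S = e + int p * t" by simp
  define R where "R = (\<Sum>j\<in>{1..m}. (of_nat p * bernoulli (m - j)) *
    (of_nat (m choose j) * (of_nat p ^ (j - 1) / of_nat (Suc j))))"
  have "of_nat p * bernoulli m = of_int S -
     (\<Sum>j\<in>{1..m}. of_nat (m choose j) * (of_nat p * bernoulli (m - j)) * (of_nat p ^ j / of_nat (Suc j)))"
    by (subst bernoulli_as_power_sum[OF p0, of m]) (simp add: S_def)
  also have "(\<Sum>j\<in>{1..m}. of_nat (m choose j) * (of_nat p * bernoulli (m - j)) * (of_nat p ^ j / of_nat (Suc j)))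
      = of_nat p * R"
    unfolding R_def sum_distrib_left
  proof (rule sum.cong)
    fix j assume "j \<in> {1..m}"
    then obtain i where "j = Suc i" by (cases j) auto
    thus "of_nat (m choose j) * (of_nat p * bernoulli (m - j)) * (of_nat p ^ j / of_nat (Suc j)) =
        of_nat p * (of_nat p * bernoulli (m - j) * (of_nat (m choose j) * (of_nat p ^ (j - 1) / of_nat (Suc j))))"
      by (simp add: mult_ac)
  qed simp
  finally have "bernoulli m = of_int e / of_nat p + of_int t - R"
    using p0 t by (simp add: field_simps)
  hence eq: "bernoulli m + (if (p - 1) dvd m then 1 / of_nat p else 0) = of_int t - R"
    by (simp add: e_def)
  have "p_integral p R"
    unfolding R_def
  proof (intro p_integral_sum p_integral_mult[OF assms(1) p_integral_prime_times_bernoulli] assms)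
    fix j assume j: "j \<in> {1..m}"
    show "p_integral p (of_nat (m choose j) * (of_nat p ^ (j - 1) / of_nat (Suc j)))"
    \<comment> \<open>In this exceptional case the binomial coefficient is m, and its evenness
      cancels the denominator 2.\<close>
    proof (cases "p = 2 \<and> j = 1")
      case True
      from \<open>even m\<close> obtain n where "m = 2 * n" by blast
      with True show ?thesis using assms(1) by simp
    next
      case False
      with j show ?thesis
        by (intro p_integral_mult prime_power_over_Suc(2) assms p_integral_of_nat) auto
    qed
  qed
  thus ?thesis
    unfolding eq using assms(1) by (intro p_integral_diff p_integral_of_int)
qed

lemma p_part_bernoulli_denom:
  assumes "prime p" "n \<ge> 1"
  shows "p_part p (bernoulli_denom n) = (if (p - 1) dvd 2 * n then p else 1)"
proof -
  obtain a b where q: "quotient_of (bernoulli (2 * n)) = (a, b)" by force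
  have r: "bernoulli (2 * n) = of_int a / of_int b" and b: "b > 0" and cop: "coprime a b"
    using q by (auto simp: quotient_of_div quotient_of_denom_pos quotient_of_coprime)
  have den: "bernoulli_denom n = nat b" by (simp add: bernoulli_denom_def q)
  have p2: "p \<ge> 2" using assms(1) by (rule prime_ge_2_nat)
  have vs: "p_integral p (bernoulli (2 * n) + (if (p - 1) dvd 2 * n then 1 / of_nat p else 0))"
    using assms by (intro von_Staudt_Clausen) auto
  show ?thesis
  proof (cases "(p - 1) dvd 2 * n")
    case False
    with vs have "\<not> int p dvd b"
      using p_integral_iff_not_dvd_denom[OF assms(1)] by (simp add: q)
    hence "\<not> p dvd nat b" using b by (simp add: int_dvd_int_iff [symmetric])
    thus ?thesis using False by (simp add: den p_part_def not_dvd_imp_multiplicity_0)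
  next
    case True
    with vs have i: "p_integral p (bernoulli (2 * n) + 1 / of_nat p)" by simp
    have pb: "int p dvd b"
    proof (rule ccontr)
      assume "\<not> int p dvd b"
      hence "p_integral p (bernoulli (2 * n))"
        using p_integral_iff_not_dvd_denom[OF assms(1)] by (simp add: q)
      from p_integral_diff[OF assms(1) i this] obtain c d where
        cd: "\<not> int p dvd d" "1 / of_nat p = (of_int c / of_int d :: rat)"
        by (auto simp: p_integral_def)
      hence "(of_int d :: rat) = of_int (int p * c)" using p2 by (auto simp: field_simps)
      hence "d = int p * c" by linarith
      with cd show False by simp
    qed
    then obtain b' where b': "b = int p * b'" by blast
    \<comment> \<open>Here B_(2n) + 1/p = (a + b')/(p b') is p-integral, so p divides a + b'. A
      second factor p in \<open>b\<close> would then make p divide a as well.\<close>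
    have "\<not> int p dvd b'"
    proof
      assume pb': "int p dvd b'"
      from i obtain c d where
        cd: "\<not> int p dvd d" "bernoulli (2 * n) + 1 / of_nat p = (of_int c / of_int d :: rat)"
        by (auto simp: p_integral_def)
      have "d \<noteq> 0" "b' \<noteq> 0" using cd b b' by auto
      with cd(2) p2 have "(of_int ((a + b') * d) :: rat) = of_int (c * (int p * b'))"
        unfolding r b' by (simp add: field_simps)
      hence "(a + b') * d = c * (int p * b')" by linarith
      hence "int p dvd (a + b') * d" by simp
      hence "int p dvd a + b'" using cd assms(1) by (simp add: prime_dvd_mult_iff)
      hence "int p dvd a" using pb' dvd_add_left_iff by blast
      with pb cop have "is_unit (int p)" by (meson coprime_common_divisor)
      thus False using assms(1) by simp
    qed
    moreover have "b' > 0" using b b' p2 by (simp add: zero_less_mult_iff)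
    ultimately have "multiplicity p (p * nat b') = Suc 0"
      using assms(1) p2
      by (simp add: multiplicity_times_same not_dvd_imp_multiplicity_0 int_dvd_int_iff [symmetric])
    thus ?thesis using True p2
      by (simp add: den p_part_def b' nat_mult_distrib)
  qed
qed

section \<open>Local realisability\<close>

text \<open>
  Sequences over \<open>\<int>[1/p] / \<int>\<close> with characteristic polynomial \<open>f\<close>, under the shift. The ones of
  period \<open>n\<close> form the kernel of the circulant matrix of \<open>f\<close>.
\<close>

lemma realisable_p_part_det_circulant:
  assumes p: "prime p" and det: "\<And>n. n \<ge> 1 \<Longrightarrow> det (circulant n f) \<noteq> 0"
  shows "realisable (\<lambda>n. p_part p (nat \<bar>det (circulant n f)\<bar>))"
proof -
  let ?U = "unit_p_fractions p"
  define X where "X = {a :: nat \<Rightarrow> rat. (\<forall>i. a i \<in> ?U) \<and>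
    (\<forall>i. (\<Sum>k\<le>degree f. of_int (Polynomial.coeff f k) * a (i + k)) \<in> \<int>)}"
  define T where "T = (\<lambda>(a :: nat \<Rightarrow> rat) i. a (Suc i))"
  have pow: "(T ^^ n) a = (\<lambda>i. a (i + n))" for n a
    by (induction n) (auto simp: T_def)
  have TX: "T \<in> X \<rightarrow> X"
    unfolding X_def T_def by (auto simp flip: add_Suc)
  have "realised_by (\<lambda>n. p_part p (nat \<bar>det (circulant n f)\<bar>)) X T"
    unfolding realised_by_def
  proof (intro conjI allI impI TX)
    fix n :: nat assume n: "n \<ge> 1"
    define K where "K = {x \<in> {..<n} \<rightarrow>\<^sub>E ?U. integral_image n (circulant n f) x}"
    have K: "finite K" "card K = p_part p (nat \<bar>det (circulant n f)\<bar>)"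
      using card_torsion_kernel[OF p circulant_carrier det[OF n]] by (simp_all add: K_def)
    have im: "integral_image n (circulant n f) x \<longleftrightarrow>
      (\<forall>i<n. (\<Sum>k\<le>degree f. of_int (Polynomial.coeff f k) * x ((i + k) mod n)) \<in> \<int>)" for x
      by (simp add: integral_image_def circulant_apply)
    \<comment> \<open>Period \<open>n\<close> means that each value depends only on the index modulo
      \<open>n\<close>.\<close>
    have per: "a \<in> periodic_points n X T \<longleftrightarrow> a \<in> X \<and> (\<forall>i. a (i mod n) = a i)" for a
    proof -
      have "a (i mod n) = a i" if "\<And>i. a (i + n) = a i" for i
      proof -
        have "a (j + m * n) = a j" for j m
          using that[of "j + m * n" for m] by (induction m) (auto simp: algebra_simps)
        from this[of "i mod n" "i div n"] show ?thesis by simp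
      qed
      moreover have "a (i + n) = a i" if "\<And>i. a (i mod n) = a i" for i
        using that[of "i + n"] that[of i] by simp
      ultimately show ?thesis
        by (auto simp: periodic_points_def pow fun_eq_iff)
    qed
    have "bij_betw (\<lambda>a. restrict a {..<n}) (periodic_points n X T) K"
    proof (rule bij_betw_byWitness[where f' = "\<lambda>x i. x (i mod n)"])
      show "\<forall>a\<in>periodic_points n X T. (\<lambda>i. restrict a {..<n} (i mod n)) = a"
        using n by (auto simp: per)
      show "\<forall>x\<in>K. restrict (\<lambda>i. x (i mod n)) {..<n} = x"
        by (auto simp: K_def fun_eq_iff PiE_iff extensional_def)
      show "(\<lambda>a. restrict a {..<n}) ` periodic_points n X T \<subseteq> K"
      proof
        fix x assume "x \<in> (\<lambda>a. restrict a {..<n}) ` periodic_points n X T"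
        then obtain a where a: "a \<in> X" "\<And>i. a (i mod n) = a i" and x: "x = restrict a {..<n}"
          by (auto simp: per)
        have "x ((i + k) mod n) = a (i + k)" for i k
          using a(2) n by (simp add: x)
        moreover have "x \<in> {..<n} \<rightarrow>\<^sub>E ?U"
          using a(1) by (auto simp: x X_def)
        ultimately show "x \<in> K"
          using a(1) by (simp add: K_def im X_def)
      qed
      show "(\<lambda>x i. x (i mod n)) ` K \<subseteq> periodic_points n X T"
      proof
        fix a assume "a \<in> (\<lambda>x i. x (i mod n)) ` K"
        then obtain x where x: "x \<in> K" and a: "a = (\<lambda>i. x (i mod n))" by auto
        \<comment> \<open>Membership in \<open>K\<close> gives the recurrence only at positions
          below \<open>n\<close>; periodicity carries it to every position.\<close>
        have "(\<Sum>k\<le>degree f. of_int (Polynomial.coeff f k) * x ((i + k) mod n)) \<in> \<int>" for i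
        proof -
          have "i mod n < n" using n by simp
          hence "(\<Sum>k\<le>degree f. of_int (Polynomial.coeff f k) * x ((i mod n + k) mod n)) \<in> \<int>"
            using x by (simp add: K_def im)
          thus ?thesis by (simp add: mod_add_left_eq)
        qed
        moreover have "x (i mod n) \<in> ?U" for i
          using x n by (auto simp: K_def PiE_iff)
        ultimately have "a \<in> X" by (simp add: a X_def)
        thus "a \<in> periodic_points n X T" by (simp add: per a)
      qed
    qed
    from bij_betw_finite[OF this] bij_betw_same_card[OF this] K
    show "finite (periodic_points n X T)"
      and "card (periodic_points n X T) = p_part p (nat \<bar>det (circulant n f)\<bar>)" by simp_all
  qed
  thus ?thesis by (rule realised_by_imp_realisable)
qed

lemma Delta_pos:
  assumes "\<forall>\<alpha>\<in>#complex_roots f. \<not> root_of_unity \<alpha>" "n \<ge> 1"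
  shows "Delta f n > 0"
proof -
  have "(\<Prod>\<alpha>\<in>#M. norm (\<alpha> ^ n - 1)) > 0" if "\<forall>\<alpha>\<in>#M. \<not> root_of_unity \<alpha>" for M
    using that assms(2) by (induction M) (auto simp: root_of_unity_def)
  thus ?thesis using assms(1) by (simp add: Delta_def)
qed

text \<open>For p = 2 the 2-part is constantly 2, given by two fixed points. For p = 2m + 1, p - 1
  divides 2n exactly when m divides n, so a fixed point and two cycles of length m give the values 1
  and p.\<close>

lemma everywhere_locally_realisable_bernoulli_denom:
  "everywhere_locally_realisable bernoulli_denom"
  unfolding everywhere_locally_realisable_def locally_realisable_at_def
proof (intro allI impI conjI)
  fix n
  have "snd (quotient_of (bernoulli (2 * n))) > 0"
    by (rule quotient_of_denom_pos')
  thus "bernoulli_denom n > 0" by (simp add: bernoulli_denom_def)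
next
  fix p :: nat assume p: "prime p"
  show "realisable (\<lambda>n. p_part p (bernoulli_denom n))"
  proof (cases "p = 2")
    case True
    have "realisable (\<lambda>n. if 1 dvd n then Suc (1 * 1) else 1)"
      by (rule realisable_fixed_point_and_cycles) simp
    thus ?thesis
      using p True by (subst realisable_cong[OF p_part_bernoulli_denom[OF p]]) (auto simp: numeral_2_eq_2)
  next
    case False
    hence "odd p" using p primes_dvd_imp_eq two_is_prime_nat by blast
    then obtain m where m: "p = 2 * m + 1" by (rule oddE)
    hence "m > 0" using p by (cases m) auto
    hence "realisable (\<lambda>n. if m dvd n then Suc (2 * m) else 1)"
      by (rule realisable_fixed_point_and_cycles)
    thus ?thesis
      using m by (subst realisable_cong[OF p_part_bernoulli_denom[OF p]]) auto
  qed
qed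

theorem theorem1p4:
  shows "(\<forall>f :: int poly.
            lead_coeff f = 1 \<longrightarrow> degree f \<ge> 1 \<longrightarrow>
            (\<forall>\<alpha>\<in>#complex_roots f. \<not> root_of_unity \<alpha>) \<longrightarrow>
            (\<exists>u :: nat \<Rightarrow> nat.
               (\<forall>n\<ge>1. real (u n) = Delta f n) \<and>
               everywhere_locally_realisable u \<and> realisable u))
       \<and> (everywhere_locally_realisable bernoulli_denom \<and> realisable bernoulli_denom)"
proof (intro conjI allI impI)
  show "everywhere_locally_realisable bernoulli_denom"
    by (rule everywhere_locally_realisable_bernoulli_denom)
  thus "realisable bernoulli_denom"
    by (rule everywhere_locally_realisable_imp_realisable)
next
  fix f :: "int poly"
  assume monic: "lead_coeff f = 1" and nru: "\<forall>\<alpha>\<in>#complex_roots f. \<not> root_of_unity \<alpha>"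
  \<comment> \<open>The determinant supplies the natural number whose real value is
    \<open>Delta f n\<close>. It is nonzero since no root of f is a root of unity.\<close>
  define u where "u = (\<lambda>n. nat \<bar>det (circulant n f)\<bar>)"
  have u: "real (u n) = Delta f n" if "n \<ge> 1" for n
    using abs_det_circulant[OF monic, of n] that by (simp add: u_def)
  have upos: "u n > 0" if "n \<ge> 1" for n
    using Delta_pos[OF nru that] u[OF that] by simp
  have "det (circulant n f) \<noteq> 0" if "n \<ge> 1" for n
    using upos[OF that] by (simp add: u_def)
  hence elr: "everywhere_locally_realisable u"
    unfolding everywhere_locally_realisable_def locally_realisable_at_def
    using upos realisable_p_part_det_circulant[of _ f] by (simp add: u_def)
  show "\<exists>u :: nat \<Rightarrow> nat. (\<forall>n\<ge>1. real (u n) = Delta f n) \<and>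
      everywhere_locally_realisable u \<and> realisable u"
    using u elr everywhere_locally_realisable_imp_realisable[OF elr] by blast
qed

end
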